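(* Let $(Q,+)$ be a group, $\varphi,\psi\in Aut(Q,+)$, $\beta,\gamma\in S_Q$, and let $\overline{\psi}=I\psi$ (so $\overline{\psi}x=-\psi x$). The left linear quasigroup $(Q,\cdot)$ given by $x\cdot y=\varphi x+\beta y$ and the quasigroup $(Q,\circ)$ given by $x\circ y=\gamma y+\overline{\psi}x$ are orthogonal if and only if the mapping $(\psi^{-1}\gamma+\varphi^{-1}\beta)$, i.e. $y\mapsto\psi^{-1}\gamma y+\varphi^{-1}\beta y$, is a permutation of the set $Q$.
   Context: Groups are written additively but need not be commutative. $S_Q$ is the set of all permutations (bijections) of the set $Q$. Products of maps are compositions, $(\alpha\beta)x=\alpha(\beta x)$. $I$ denotes the map $Ix=-x$; every anti-automorphism $\overline{\psi}$ of the group $(Q,+)$ (a permutation of $Q$ with $\overline{\psi}(x+y)=\overline{\psi}y+\overline{\psi}x$) is written $\overline{\psi}=I\psi$ with $\psi\in Aut(Q,+)$. Two quasigroups $(Q,\cdot)$ and $(Q,\circ)$ on the same set are orthogonal if for all $a,b\in Q$ the system $x\cdot y=a$, $x\circ y=b$ has a unique solution $(x,y)\in Q\times Q$. *)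

theory Defs
  imports "HOL-Algebra.Group"
begin

definition quasigroup_on :: "'a set \<Rightarrow> ('a \<Rightarrow> 'a \<Rightarrow> 'a) \<Rightarrow> bool" where
  "quasigroup_on Q f \<longleftrightarrow>
     (\<forall>x\<in>Q. \<forall>y\<in>Q. f x y \<in> Q) \<and>
     (\<forall>a\<in>Q. \<forall>b\<in>Q. \<exists>!x. x \<in> Q \<and> f x a = b) \<and>
     (\<forall>a\<in>Q. \<forall>b\<in>Q. \<exists>!y. y \<in> Q \<and> f a y = b)"

(* Uniqueness is that of the pair (x, y); a nested unique existence, first of x
   and then of y, would be a weaker condition. *)
definition orthogonal_quasigroups ::
    "'a set \<Rightarrow> ('a \<Rightarrow> 'a \<Rightarrow> 'a) \<Rightarrow> ('a \<Rightarrow> 'a \<Rightarrow> 'a) \<Rightarrow> bool" where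
  "orthogonal_quasigroups Q f g \<longleftrightarrow>
     quasigroup_on Q f \<and> quasigroup_on Q g \<and>
     (\<forall>a\<in>Q. \<forall>b\<in>Q. \<exists>!p. p \<in> Q \<times> Q \<and> f (fst p) (snd p) = a \<and> g (fst p) (snd p) = b)"

end

(* Applying the inverses of phi and psi to the two equations x . y = a and x o y = b gives
   x + R y = A and P y - x = B, where P and R are psi^-1 gamma and phi^-1 beta, A is phi^-1 a
   and B is psi^-1 b.  Eliminating x = A - R y leaves P y + R y = B + A, and B + A takes every
   value in Q.  Hence unique solvability of the system for all a, b is bijectivity of P + R. *)
theory Submission
  imports Defs
begin

text \<open>Bridges to the definitions: the quasigroup axioms and orthogonality are phrased as
  unique solvability, while composition arguments need bijections.\<close>

lemma bij_betw_iff_ex1: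
  "bij_betw f A B \<longleftrightarrow> f \<in> A \<rightarrow> B \<and> (\<forall>b\<in>B. \<exists>!x. x \<in> A \<and> f x = b)"
proof
  assume "bij_betw f A B"
  then show "f \<in> A \<rightarrow> B \<and> (\<forall>b\<in>B. \<exists>!x. x \<in> A \<and> f x = b)"
    unfolding bij_betw_def inj_on_def by blast
next
  assume R: "f \<in> A \<rightarrow> B \<and> (\<forall>b\<in>B. \<exists>!x. x \<in> A \<and> f x = b)"
  then have "inj_on f A"
    by (intro inj_onI) (metis PiE)
  moreover have "f ` A = B"
    using R by blast
  ultimately show "bij_betw f A B"
    by (simp add: bij_betw_def)
qed

text \<open>A point on the graph of \<open>g\<close> is determined by its second component, so
  uniqueness of the pair and uniqueness of that component amount to the same. This is what allows
  one unknown to be eliminated.\<close>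

lemma ex1_pair_graph_iff: "(\<exists>!p. K (snd p) \<and> fst p = g (snd p)) \<longleftrightarrow> (\<exists>!y. K y)"
proof
  assume "\<exists>!p. K (snd p) \<and> fst p = g (snd p)"
  then obtain p where p: "K (snd p)"
    and unique: "\<And>q. K (snd q) \<and> fst q = g (snd q) \<Longrightarrow> q = p"
    by (elim ex1E) blast
  have "y = snd p" if "K y" for y
    using unique[of "(g y, y)"] that by auto
  with p show "\<exists>!y. K y"
    by (intro ex1I)
next
  assume "\<exists>!y. K y"
  then obtain y where y: "K y" and unique: "\<And>z. K z \<Longrightarrow> z = y"
    by (elim ex1E) blast
  show "\<exists>!p. K (snd p) \<and> fst p = g (snd p)"
    by (rule ex1I[of _ "(g y, y)"]) (auto simp: y prod_eq_iff dest: unique)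
qed

lemma quasigroup_on_iff_bij_betw:
  "quasigroup_on Q f \<longleftrightarrow>
     (\<forall>a\<in>Q. bij_betw (\<lambda>x. f x a) Q Q) \<and> (\<forall>a\<in>Q. bij_betw (\<lambda>y. f a y) Q Q)"
  unfolding quasigroup_on_def bij_betw_iff_ex1 Pi_iff ball_conj_distrib by (safe; simp only:)

lemma quasigroup_on_flip: "quasigroup_on Q f \<Longrightarrow> quasigroup_on Q (\<lambda>x y. f y x)"
  unfolding quasigroup_on_iff_bij_betw by blast

text \<open>Each translation of the new operation is a translation of \<open>f\<close>, by
  \<open>s a\<close> or \<open>t a\<close>, precomposed with \<open>s\<close> or \<open>t\<close>;
  so it is a composition of bijections.\<close>

lemma quasigroup_on_isotope:
  assumes f: "quasigroup_on Q f" and s: "bij_betw s Q Q" and t: "bij_betw t Q Q"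
  shows "quasigroup_on Q (\<lambda>x y. f (s x) (t y))"
  unfolding quasigroup_on_iff_bij_betw
proof (intro conjI ballI)
  fix a assume "a \<in> Q"
  then have "s a \<in> Q" "t a \<in> Q"
    using s t by (auto dest: bij_betwE)
  then have "bij_betw (\<lambda>x. f x (t a)) Q Q" "bij_betw (\<lambda>y. f (s a) y) Q Q"
    using f by (auto simp: quasigroup_on_iff_bij_betw)
  then show "bij_betw (\<lambda>x. f (s x) (t a)) Q Q" "bij_betw (\<lambda>y. f (s a) (t y)) Q Q"
    using bij_betw_trans[OF s] bij_betw_trans[OF t] by (auto simp: o_def)
qed

context group
begin

lemma bij_betw_m_inv: "bij_betw (\<lambda>x. inv x) (carrier G) (carrier G)"
  by (rule bij_betw_byWitness[where f' = "\<lambda>x. inv x"]) auto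

lemma quasigroup_on_mult: "quasigroup_on (carrier G) (\<otimes>)"
  unfolding quasigroup_on_iff_bij_betw
proof (intro conjI ballI)
  fix a assume a: "a \<in> carrier G"
  show "bij_betw (\<lambda>x. x \<otimes> a) (carrier G) (carrier G)"
    by (rule bij_betw_byWitness[where f' = "\<lambda>x. x \<otimes> inv a"]) (use a in \<open>auto simp: m_assoc\<close>)
  show "bij_betw (\<lambda>y. a \<otimes> y) (carrier G) (carrier G)"
    by (rule bij_betw_byWitness[where f' = "\<lambda>y. inv a \<otimes> y"]) (use a in \<open>auto simp: m_assoc[symmetric]\<close>)
qed

text \<open>The elimination in the group: the first equation determines \<open>x\<close>, and the
  second says \<open>p = B \<otimes> x\<close>. The order of the factors matters, since
  commutativity is not assumed.\<close>

lemma mult_eq_and_mult_inv_eq_iff: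
  assumes "x \<in> carrier G" "p \<in> carrier G" "r \<in> carrier G" "A \<in> carrier G" "B \<in> carrier G"
  shows "x \<otimes> r = A \<and> p \<otimes> inv x = B \<longleftrightarrow> x = A \<otimes> inv r \<and> p \<otimes> r = B \<otimes> A"
proof -
  have "x \<otimes> r = A \<longleftrightarrow> x = A \<otimes> inv r"
    using assms by (metis inv_solve_right)
  moreover have "p \<otimes> inv x = B \<longleftrightarrow> p \<otimes> r = B \<otimes> A" if A: "x \<otimes> r = A"
  proof -
    have "p \<otimes> inv x = B \<longleftrightarrow> p = B \<otimes> x"
      using assms by (metis inv_solve_right')
    \<comment> \<open>Cancellation lets \<open>r\<close> be multiplied on the right, which produces
      the product \<open>x \<otimes> r\<close>, known to be \<open>A\<close>.\<close>
    also have "\<dots> \<longleftrightarrow> p \<otimes> r = B \<otimes> x \<otimes> r"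
      using assms by simp
    finally show ?thesis
      using assms A by (simp add: m_assoc)
  qed
  ultimately show ?thesis
    by blast
qed

end

theorem theorem31:
  fixes G (structure) and \<phi> \<psi> \<beta> \<gamma> :: "'a \<Rightarrow> 'a"
  assumes "group G"
    and "\<phi> \<in> iso G G" and "\<psi> \<in> iso G G"
    and "bij_betw \<beta> (carrier G) (carrier G)" and "bij_betw \<gamma> (carrier G) (carrier G)"
  shows "quasigroup_on (carrier G) (\<lambda>x y. \<phi> x \<otimes> \<beta> y) \<and>
    quasigroup_on (carrier G) (\<lambda>x y. \<gamma> y \<otimes> inv (\<psi> x)) \<and>
    (orthogonal_quasigroups (carrier G) (\<lambda>x y. \<phi> x \<otimes> \<beta> y) (\<lambda>x y. \<gamma> y \<otimes> inv (\<psi> x)) \<longleftrightarrow>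
     bij_betw (\<lambda>y. inv_into (carrier G) \<psi> (\<gamma> y) \<otimes> inv_into (carrier G) \<phi> (\<beta> y))
       (carrier G) (carrier G))"
proof -
  interpret group G by fact
  let ?Q = "carrier G"
  define P where "P y = inv_into ?Q \<psi> (\<gamma> y)" for y
  define R where "R y = inv_into ?Q \<phi> (\<beta> y)" for y
  have bij: "bij_betw \<phi> ?Q ?Q" "bij_betw \<psi> ?Q ?Q" and hom: "\<phi> \<in> hom G G" "\<psi> \<in> hom G G"
    using assms by (auto simp: iso_def)
  have closed: "P y \<in> ?Q" "R y \<in> ?Q" and P: "\<psi> (P y) = \<gamma> y" and R: "\<phi> (R y) = \<beta> y"
    if "y \<in> ?Q" for y
  proof -
    \<comment> \<open>Surjectivity of the automorphisms is what makes \<open>inv_into\<close> a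
      genuine right inverse at these points.\<close>
    have "\<gamma> y \<in> \<psi> ` ?Q" "\<beta> y \<in> \<phi> ` ?Q"
      using assms(4,5) bij that by (auto simp: bij_betw_def)
    then show "P y \<in> ?Q" "R y \<in> ?Q" "\<psi> (P y) = \<gamma> y" "\<phi> (R y) = \<beta> y"
      unfolding P_def R_def by (auto intro: inv_into_into f_inv_into_f)
  qed
  have quasi1: "quasigroup_on ?Q (\<lambda>x y. \<phi> x \<otimes> \<beta> y)"
    by (rule quasigroup_on_isotope[OF quasigroup_on_mult bij(1) assms(4)])
  have "bij_betw (\<lambda>x. inv (\<psi> x)) ?Q ?Q"
    using bij_betw_trans[OF bij(2) bij_betw_m_inv] by (simp add: o_def)
  \<comment> \<open>In the second operation \<open>y\<close> stands in the left factor, so it is an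
    isotope of the group with its arguments exchanged.\<close>
  from quasigroup_on_flip[OF quasigroup_on_isotope[OF quasigroup_on_mult assms(5) this]]
  have quasi2: "quasigroup_on ?Q (\<lambda>x y. \<gamma> y \<otimes> inv (\<psi> x))" .
  have system: "\<phi> x \<otimes> \<beta> y = \<phi> A \<and> \<gamma> y \<otimes> inv (\<psi> x) = \<psi> B \<longleftrightarrow>
      x = A \<otimes> inv (R y) \<and> P y \<otimes> R y = B \<otimes> A"
    if "x \<in> ?Q" "y \<in> ?Q" "A \<in> ?Q" "B \<in> ?Q" for x y A B
  proof -
    interpret \<phi>: group_hom G G \<phi> by unfold_locales (rule hom)
    interpret \<psi>: group_hom G G \<psi> by unfold_locales (rule hom)
    \<comment> \<open>Since \<open>\<beta> y = \<phi> (R y)\<close> and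
      \<open>\<gamma> y = \<psi> (P y)\<close>, each left-hand side is the image of a single
      product; injectivity then strips off \<open>\<phi>\<close> and \<open>\<psi>\<close>.\<close>
    have "\<phi> x \<otimes> \<beta> y = \<phi> (x \<otimes> R y)" "\<gamma> y \<otimes> inv (\<psi> x) = \<psi> (P y \<otimes> inv x)"
      using that closed by (simp_all add: P R)
    moreover have "\<phi> (x \<otimes> R y) = \<phi> A \<longleftrightarrow> x \<otimes> R y = A"
      by (rule inj_on_eq_iff[OF bij_betw_imp_inj_on[OF bij(1)]]) (use that closed in auto)
    moreover have "\<psi> (P y \<otimes> inv x) = \<psi> B \<longleftrightarrow> P y \<otimes> inv x = B"
      by (rule inj_on_eq_iff[OF bij_betw_imp_inj_on[OF bij(2)]]) (use that closed in auto)
    ultimately have "\<phi> x \<otimes> \<beta> y = \<phi> A \<and> \<gamma> y \<otimes> inv (\<psi> x) = \<psi> B \<longleftrightarrow>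
        x \<otimes> R y = A \<and> P y \<otimes> inv x = B"
      by (simp only:)
    then show ?thesis
      using mult_eq_and_mult_inv_eq_iff that closed by simp
  qed
  have unique: "(\<exists>!p. p \<in> ?Q \<times> ?Q \<and> \<phi> (fst p) \<otimes> \<beta> (snd p) = \<phi> A \<and>
        \<gamma> (snd p) \<otimes> inv (\<psi> (fst p)) = \<psi> B) \<longleftrightarrow> (\<exists>!y. y \<in> ?Q \<and> P y \<otimes> R y = B \<otimes> A)"
    if AB: "A \<in> ?Q" "B \<in> ?Q" for A B
  proof -
    have "p \<in> ?Q \<times> ?Q \<and> \<phi> (fst p) \<otimes> \<beta> (snd p) = \<phi> A \<and> \<gamma> (snd p) \<otimes> inv (\<psi> (fst p)) = \<psi> B
        \<longleftrightarrow> (snd p \<in> ?Q \<and> P (snd p) \<otimes> R (snd p) = B \<otimes> A) \<and> fst p = A \<otimes> inv (R (snd p))" for p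
      using system[of "fst p" "snd p" A B] AB closed by (cases p) auto
    then show ?thesis
      using ex1_pair_graph_iff[where K = "\<lambda>y. y \<in> ?Q \<and> P y \<otimes> R y = B \<otimes> A"
          and g = "\<lambda>y. A \<otimes> inv (R y)"]
      by (simp only:)
  qed
  have image: "\<phi> ` ?Q = ?Q" "\<psi> ` ?Q = ?Q"
    using bij by (auto simp: bij_betw_def)
  \<comment> \<open>Writing the carrier as an image under \<open>\<phi>\<close> and
    \<open>\<psi>\<close> turns arbitrary right-hand sides into \<open>\<phi> A\<close> and
    \<open>\<psi> B\<close>.\<close>
  have "orthogonal_quasigroups ?Q (\<lambda>x y. \<phi> x \<otimes> \<beta> y) (\<lambda>x y. \<gamma> y \<otimes> inv (\<psi> x)) \<longleftrightarrow>
      (\<forall>a\<in>\<phi> ` ?Q. \<forall>b\<in>\<psi> ` ?Q. \<exists>!p. p \<in> ?Q \<times> ?Q \<and> \<phi> (fst p) \<otimes> \<beta> (snd p) = a \<and>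
        \<gamma> (snd p) \<otimes> inv (\<psi> (fst p)) = b)"
    by (simp only: orthogonal_quasigroups_def image quasi1 quasi2 simp_thms)
  also have "\<dots> \<longleftrightarrow> (\<forall>A\<in>?Q. \<forall>B\<in>?Q. \<exists>!y. y \<in> ?Q \<and> P y \<otimes> R y = B \<otimes> A)"
    by (simp only: ball_simps unique cong: ball_cong)
  also have "\<dots> \<longleftrightarrow> (\<forall>c\<in>?Q. \<exists>!y. y \<in> ?Q \<and> P y \<otimes> R y = c)"
  proof
    assume *: "\<forall>A\<in>?Q. \<forall>B\<in>?Q. \<exists>!y. y \<in> ?Q \<and> P y \<otimes> R y = B \<otimes> A"
    show "\<forall>c\<in>?Q. \<exists>!y. y \<in> ?Q \<and> P y \<otimes> R y = c"
    proof
      fix c assume "c \<in> ?Q"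
      \<comment> \<open>The choice of the neutral element for \<open>A\<close> and \<open>c\<close>
        for \<open>B\<close> already reaches every value \<open>c\<close>.\<close>
      with * have "\<exists>!y. y \<in> ?Q \<and> P y \<otimes> R y = c \<otimes> \<one>"
        by blast
      with \<open>c \<in> ?Q\<close> show "\<exists>!y. y \<in> ?Q \<and> P y \<otimes> R y = c"
        by simp
    qed
  next
    assume "\<forall>c\<in>?Q. \<exists>!y. y \<in> ?Q \<and> P y \<otimes> R y = c"
    then show "\<forall>A\<in>?Q. \<forall>B\<in>?Q. \<exists>!y. y \<in> ?Q \<and> P y \<otimes> R y = B \<otimes> A"
      by simp
  qed
  also have "\<dots> \<longleftrightarrow> bij_betw (\<lambda>y. P y \<otimes> R y) ?Q ?Q"
    using closed by (auto simp: bij_betw_iff_ex1)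
  finally show ?thesis
    using quasi1 quasi2 by (simp add: P_def R_def)
qed

end
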